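(* Let $\Phi\in(-\pi,\pi]^{n\times n}$ and let $x=\chi\odot\exp(j\Phi)\in\Omega_2$. Then $$P_{\Omega_3}(x)=\big\{\chi\odot\exp(j\varphi)\ \big|\ \exists J\in C_s(\Phi)\text{ such that }\varphi=\Phi\text{ on }J\text{ and }\varphi=0\text{ on }\mathcal{J}\setminus J\big\},$$ where $\varphi$ ranges over real $n\times n$ arrays.
   Context: The underlying space is $\mathbb{C}^{n\times n}$ with the Frobenius norm $\|\cdot\|$; $j$ is the imaginary unit; $\odot$ is element-wise multiplication; $\exp$, $|\cdot|$ and $\arg$ are applied element-wise, with $\arg$ taking values in $(-\pi,\pi]$; $\|\cdot\|_0$ is the number of nonzero entries. The array $\chi\in\mathbb{R}_+^{n\times n}$ is uniform: all its entries equal the same constant $r>0$. The integer $s$ satisfies $0\le s\le n^2$. Constraint sets: $\Omega_2=\{x\in\mathbb{C}^{n\times n}: |x|=\chi\}$ and $\Omega_3=\{x\in\Omega_2: \|\arg(x)\|_0\le s\}$. For a set $\Omega\subset\mathbb{C}^{n\times n}$, the (set-valued) projector is $P_\Omega(x)=\{w\in\Omega: \|x-w\|=\inf_{v\in\Omega}\|x-v\|\}$. $\mathcal{J}=\{(r',c'): 1\le r',c'\le n\}$ is the set of all indices, and $\mathcal{J}_s$ is the set of all $s$-element subsets of $\mathcal{J}$. For a real or complex $n\times n$ array $\mathcal{O}$, $$C_s(\mathcal{O})=\Big\{J\in\mathcal{J}_s: \min_{\xi\in J}|\mathcal{O}(\xi)|\ge\max_{\xi\in\mathcal{J}\setminus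 J}|\mathcal{O}(\xi)|\Big\},$$ where the condition is regarded as satisfied if $J$ or $\mathcal{J}\setminus J$ is empty. *)

theory Defs
  imports "HOL-Analysis.Analysis"
begin

text \<open>
  An \<open>n \<times> n\<close> array is a \<open>'a ^ 'n ^ 'n\<close> with \<open>CARD('n) = n\<close>. On this type the norm
  of the library (Euclidean norm of the Euclidean norms of the rows) is the Frobenius norm, and
  the multiplication \<open>*\<close> is entrywise (it is not the matrix product \<open>**\<close>); we write it
  \<open>\<odot>\<close>. The function \<open>Arg\<close> takes values in \<open>(-pi, pi]\<close>, and \<open>Arg 0 = 0\<close>. The
  modulus array \<open>\<chi>\<close> is called \<open>X\<close>, since \<open>\<chi>\<close> is binder syntax for vectors.
\<close>

abbreviation hadamard :: "('a::times) ^ 'n ^ 'n \<Rightarrow> 'a ^ 'n ^ 'n \<Rightarrow> 'a ^ 'n ^ 'n"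
    (infixl \<open>\<odot>\<close> 70)
  where "x \<odot> y \<equiv> x * y"

abbreviation entry :: "'a ^ 'n ^ 'n \<Rightarrow> 'n \<times> 'n \<Rightarrow> 'a"
  where "entry M \<xi> \<equiv> M $ fst \<xi> $ snd \<xi>"

definition norm0 :: "('a::zero) ^ 'n ^ 'n \<Rightarrow> nat"
  where "norm0 M = card {\<xi>. entry M \<xi> \<noteq> 0}"

definition cexp_array :: "real ^ 'n ^ 'n \<Rightarrow> complex ^ 'n ^ 'n"
  where "cexp_array \<phi> = map_matrix (\<lambda>t. exp (\<i> * complex_of_real t)) \<phi>"

definition Omega2 :: "real ^ 'n ^ 'n \<Rightarrow> (complex ^ 'n ^ 'n) set"
  where "Omega2 X = {x. map_matrix cmod x = X}"

definition Omega3 :: "real ^ 'n ^ 'n \<Rightarrow> nat \<Rightarrow> (complex ^ 'n ^ 'n) set"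
  where "Omega3 X s = {x \<in> Omega2 X. norm0 (map_matrix Arg x) \<le> s}"

definition projector :: "('a::real_normed_vector) set \<Rightarrow> 'a \<Rightarrow> 'a set"
  where "projector \<Omega> x = {w \<in> \<Omega>. norm (x - w) = (INF v\<in>\<Omega>. norm (x - v))}"

text \<open>
  The index set \<open>\<J>\<close> is \<open>UNIV :: ('n \<times> 'n) set\<close>, so \<open>- J\<close> is \<open>\<J> \<setminus> J\<close>. The cases of an empty
  \<open>J\<close> or \<open>- J\<close> are separated because \<open>Min\<close> and \<open>Max\<close> are unspecified on the empty set.
\<close>

definition C_sets :: "nat \<Rightarrow> ('a::real_normed_vector) ^ 'n ^ 'n \<Rightarrow> ('n \<times> 'n) set set"
  where "C_sets s M = {J. card J = s \<and>
    (J = {} \<or> - J = {} \<or>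
      Min ((\<lambda>\<xi>. norm (entry M \<xi>)) ` J) \<ge> Max ((\<lambda>\<xi>. norm (entry M \<xi>)) ` (- J)))}"

lemma polar_in_Omega2:
  assumes "\<And>a b. X $ a $ b \<ge> 0"
  shows "map_matrix complex_of_real X \<odot> cexp_array \<phi> \<in> Omega2 X"
  using assms by (simp add: Omega2_def cexp_array_def vec_eq_iff norm_mult)

end

theory Submission
  imports Defs
begin

text \<open>
  The squared distance from \<open>x\<close> to an array \<open>w\<close> is a sum over the indices, so the indices compete
  independently except for the budget \<open>s\<close>. Where \<open>w\<close> has argument \<open>0\<close>, its entry is the constant
  \<open>r\<close>, and the index costs \<open>g \<xi> = \<bar>x \<xi> - r\<bar>\<^sup>2 = 2 r\<^sup>2 (1 - cos (\<Phi> \<xi>))\<close>. At the at most \<open>s\<close>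
  other indices the cost can be made \<open>0\<close> by copying \<open>x\<close>. Hence the distance from \<open>x\<close> to
  \<open>\<Omega>\<^sub>3\<close> is governed by the problem of choosing \<open>J\<close> of size \<open>s\<close> such that the sum of \<open>g\<close> over
  \<open>- J\<close> is minimal. An exchange argument (\<open>complement_sum_minimal_iff\<close>) shows that the solutions
  are exactly the sets \<open>J\<close> on which \<open>g\<close> dominates its values on \<open>- J\<close>. Since \<open>1 - cos t\<close>
  increases strictly with \<open>\<bar>t\<bar>\<close> on \<open>{-pi..pi}\<close>, and since \<open>r\<close> is the same at all
  indices, domination for \<open>g\<close> is domination for \<open>\<bar>\<Phi>\<bar>\<close>, which is membership in \<open>C\<^sub>s(\<Phi>)\<close>.

  A minimizer \<open>w\<close> may use fewer than \<open>s\<close> nonzero arguments. Its support is then enlarged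
  arbitrarily to a set \<open>J\<close> of size \<open>s\<close>; minimality forces \<open>g = 0\<close> on the added indices, so there
  \<open>x = r = w\<close>, and \<open>w\<close> still agrees with \<open>x\<close> on all of \<open>J\<close>.
\<close>

lemma projector_iff:
  "w \<in> projector \<Omega> x \<longleftrightarrow> w \<in> \<Omega> \<and> (\<forall>v\<in>\<Omega>. norm (x - w) \<le> norm (x - v))"
proof (cases "w \<in> \<Omega>")
  case True
  have bdd: "bdd_below ((\<lambda>v. norm (x - v)) ` \<Omega>)"
    by (rule bdd_belowI[of _ 0]) auto
  have "norm (x - w) = (INF v\<in>\<Omega>. norm (x - v)) \<longleftrightarrow> (\<forall>v\<in>\<Omega>. norm (x - w) \<le> norm (x - v))"
  proof
    assume "norm (x - w) = (INF v\<in>\<Omega>. norm (x - v))"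
    then show "\<forall>v\<in>\<Omega>. norm (x - w) \<le> norm (x - v)"
      using cINF_lower[OF bdd] by simp
  next
    assume "\<forall>v\<in>\<Omega>. norm (x - w) \<le> norm (x - v)"
    then have "norm (x - w) \<le> (INF v\<in>\<Omega>. norm (x - v))"
      using True by (intro cINF_greatest) auto
    moreover have "(INF v\<in>\<Omega>. norm (x - v)) \<le> norm (x - w)"
      using bdd True by (rule cINF_lower)
    ultimately show "norm (x - w) = (INF v\<in>\<Omega>. norm (x - v))" by simp
  qed
  then show ?thesis using True by (simp add: projector_def)
qed (simp add: projector_def)

lemma norm_array_squared:
  fixes M :: "('a::real_normed_vector) ^ 'n ^ 'n"
  shows "(norm M)\<^sup>2 = (\<Sum>\<xi>\<in>UNIV. (norm (entry M \<xi>))\<^sup>2)"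
proof -
  have "(norm M)\<^sup>2 = (\<Sum>a\<in>UNIV. \<Sum>b\<in>UNIV. (norm (M $ a $ b))\<^sup>2)"
    by (simp add: norm_vec_def L2_set_def sum_nonneg)
  also have "\<dots> = (\<Sum>\<xi>\<in>UNIV. (norm (entry M \<xi>))\<^sup>2)"
    by (simp add: sum.cartesian_product case_prod_beta)
  finally show ?thesis .
qed

lemma C_sets_iff:
  fixes M :: "('a::real_normed_vector) ^ 'n ^ 'n"
  shows "J \<in> C_sets s M \<longleftrightarrow>
    card J = s \<and> (\<forall>\<xi>\<in>J. \<forall>\<eta>\<in>- J. norm (entry M \<eta>) \<le> norm (entry M \<xi>))"
proof (cases "J = {} \<or> - J = {}")
  case True
  then show ?thesis by (auto simp: C_sets_def)
next
  case False
  then show ?thesis by (auto simp: C_sets_def)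
qed

text \<open>
  Exchange argument. A dominating \<open>J\<close> beats any \<open>K\<close> of the same size because \<open>J - K\<close> and \<open>K - J\<close>
  are equinumerous, and every value on the former is at least every value on the latter. Conversely,
  a violating pair could be swapped, which would lower the sum.
\<close>
lemma complement_sum_minimal_iff:
  fixes g :: "'a::finite \<Rightarrow> real"
  shows "(\<forall>K. card K = card J \<longrightarrow> sum g (- J) \<le> sum g (- K)) \<longleftrightarrow>
    (\<forall>\<xi>\<in>J. \<forall>\<eta>\<in>- J. g \<eta> \<le> g \<xi>)"
proof (intro iffI allI ballI impI)
  fix \<xi> \<eta>
  assume min: "\<forall>K. card K = card J \<longrightarrow> sum g (- J) \<le> sum g (- K)" and mem: "\<xi> \<in> J" "\<eta> \<in> - J"
  define K where "K = insert \<eta> (J - {\<xi>})"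
  have "card J > 0" using mem by (auto simp: card_gt_0_iff)
  then have "card K = card J" using mem by (simp add: K_def card_Diff_singleton)
  then have "sum g (- J) \<le> sum g (- K)" using min by blast
  moreover have "- K = insert \<xi> (- J - {\<eta>})" using mem by (auto simp: K_def)
  moreover have "sum g (insert \<xi> (- J - {\<eta>})) = g \<xi> + sum g (- J - {\<eta>})"
    using mem by simp
  moreover have "sum g (- J) = g \<eta> + sum g (- J - {\<eta>})"
    using mem by (simp add: sum.remove)
  ultimately show "g \<eta> \<le> g \<xi>" by simp
next
  fix K :: "'a set"
  assume dom: "\<forall>\<xi>\<in>J. \<forall>\<eta>\<in>- J. g \<eta> \<le> g \<xi>" and card: "card K = card J"
  have "card (K - J) = card (J - K)"
    using card by (simp add: card_Diff_subset_Int Int_commute)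
  then obtain f where f: "bij_betw f (K - J) (J - K)"
    using finite_same_card_bij[of "K - J" "J - K"] by auto
  have "sum g (K - J) \<le> (\<Sum>\<eta>\<in>K - J. g (f \<eta>))"
    using f dom by (intro sum_mono) (auto dest: bij_betwE)
  also have "\<dots> = sum g (J - K)" using f by (rule sum.reindex_bij_betw)
  finally have "sum g (K - J) \<le> sum g (J - K)" .
  moreover have "sum g (- J) = sum g (- J - K) + sum g (K - J)"
    by (subst sum.union_disjoint[symmetric]) (auto intro!: sum.cong)
  moreover have "sum g (- K) = sum g (- J - K) + sum g (J - K)"
    by (subst sum.union_disjoint[symmetric]) (auto intro!: sum.cong)
  ultimately show "sum g (- J) \<le> sum g (- K)" by simp
qed

lemma cmod_cis_diff_1_squared: "(cmod (cis t - 1))\<^sup>2 = 2 * (1 - cos t)"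
proof -
  have "(cmod (cis t - 1))\<^sup>2 = (cos t)\<^sup>2 + (sin t)\<^sup>2 + 1 - 2 * cos t"
    by (simp add: cmod_power2 power2_diff)
  then show ?thesis by simp
qed

text \<open>
  The squared distance depends on the angle only through \<open>cos t = cos \<bar>t\<bar>\<close>, and \<open>cos\<close>
  decreases strictly on \<open>{0..pi}\<close>.
\<close>
lemma cmod_cis_diff_1_le_iff:
  assumes "\<bar>a\<bar> \<le> pi" and "\<bar>b\<bar> \<le> pi"
  shows "cmod (cis a - 1) \<le> cmod (cis b - 1) \<longleftrightarrow> \<bar>a\<bar> \<le> \<bar>b\<bar>"
proof -
  have "cos \<bar>b\<bar> \<le> cos \<bar>a\<bar> \<longleftrightarrow> \<bar>a\<bar> \<le> \<bar>b\<bar>"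
    using assms by (intro cos_mono_le_eq) auto
  then have "(cmod (cis a - 1))\<^sup>2 \<le> (cmod (cis b - 1))\<^sup>2 \<longleftrightarrow> \<bar>a\<bar> \<le> \<bar>b\<bar>"
    by (simp add: cmod_cis_diff_1_squared)
  then show ?thesis by simp
qed

lemma exists_superset_card_eq:
  fixes K :: "'a::finite set"
  assumes "card K \<le> s" and "s \<le> CARD('a)"
  obtains J where "K \<subseteq> J" and "card J = s"
  using exists_subset_between[of K s UNIV] assms by auto

theorem lemma1:
  fixes X \<Phi> :: "real ^ 'n ^ 'n" and x :: "complex ^ 'n ^ 'n" and r :: real and s :: nat
  assumes "r > 0" and "\<forall>a b. X $ a $ b = r"
    and "s \<le> CARD('n) ^ 2"
    and "\<forall>a b. \<Phi> $ a $ b \<in> {-pi<..pi}"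
    and "x = map_matrix complex_of_real X \<odot> cexp_array \<Phi>"
  shows "projector (Omega3 X s) x =
    {map_matrix complex_of_real X \<odot> cexp_array \<phi> | \<phi> :: real ^ 'n ^ 'n.
      \<exists>J\<in>C_sets s \<Phi>. (\<forall>\<xi>\<in>J. entry \<phi> \<xi> = entry \<Phi> \<xi>) \<and> (\<forall>\<xi>\<in>- J. entry \<phi> \<xi> = 0)}"
proof -
  note r = assms(1)
  have entry_polar: "entry (map_matrix complex_of_real X \<odot> cexp_array \<phi>) \<xi> = of_real r * cis (entry \<phi> \<xi>)"
    for \<phi> \<xi>
    using assms(2) by (simp add: cexp_array_def cis_conv_exp)
  have x_entry: "entry x \<xi> = of_real r * cis (entry \<Phi> \<xi>)" for \<xi>
    using entry_polar assms(5) by simp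
  have array_eqI: "M = N" if "\<And>\<xi>. entry M \<xi> = entry N \<xi>" for M N :: "'b ^ 'n ^ 'n"
    using that[of "(a, b)" for a b] by (simp add: vec_eq_iff)
  define g where "g \<xi> = (cmod (entry x \<xi> - of_real r))\<^sup>2" for \<xi>
  define restr where "restr J = (\<chi> a b. if (a, b) \<in> J then \<Phi> $ a $ b else 0)" for J
  define cand where "cand J = map_matrix complex_of_real X \<odot> cexp_array (restr J)" for J
  have restr_entry: "entry (restr J) \<xi> = (if \<xi> \<in> J then entry \<Phi> \<xi> else 0)" for J \<xi>
    by (simp add: restr_def)
  have cand_entry: "entry (cand J) \<xi> = (if \<xi> \<in> J then entry x \<xi> else of_real r)" for J \<xi>
    unfolding cand_def entry_polar restr_entry by (simp add: x_entry)
  have range: "-pi < entry \<Phi> \<xi>" "entry \<Phi> \<xi> \<le> pi" for \<xi>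
    using assms(4) by auto
  have dist2: "(norm (x - w))\<^sup>2 = (\<Sum>\<xi>\<in>UNIV. (cmod (entry x \<xi> - entry w \<xi>))\<^sup>2)" for w
    by (simp add: norm_array_squared)
  have split: "sum h UNIV = sum h J + sum h (- J)" for h :: "'n \<times> 'n \<Rightarrow> real" and J
    using sum.subset_diff[of J UNIV h] by (simp add: Compl_eq_Diff_UNIV)
  have cand_dist2: "(norm (x - cand J))\<^sup>2 = sum g (- J)" for J
    unfolding dist2 split[of _ J] by (simp add: cand_entry g_def)
  have g_le_iff: "g \<xi> \<le> g \<eta> \<longleftrightarrow> \<bar>entry \<Phi> \<xi>\<bar> \<le> \<bar>entry \<Phi> \<eta>\<bar>" for \<xi> \<eta>
  proof -
    have "g \<xi> = r\<^sup>2 * (cmod (cis (entry \<Phi> \<xi>) - 1))\<^sup>2" for \<xi>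
    proof -
      have "entry x \<xi> - of_real r = of_real r * (cis (entry \<Phi> \<xi>) - 1)"
        by (simp add: x_entry algebra_simps)
      then show ?thesis by (simp add: g_def norm_mult power_mult_distrib)
    qed
    moreover have "\<bar>entry \<Phi> \<xi>\<bar> \<le> pi" for \<xi>
      using range[of \<xi>] by (auto simp: abs_if)
    ultimately show ?thesis
      using r by (simp add: cmod_cis_diff_1_le_iff)
  qed
  have C_iff: "J \<in> C_sets s \<Phi> \<longleftrightarrow>
      card J = s \<and> (\<forall>K. card K = s \<longrightarrow> sum g (- J) \<le> sum g (- K))" for J
    using complement_sum_minimal_iff[of J g] by (auto simp: C_sets_iff g_le_iff)
  have cand_mem: "cand J \<in> Omega3 X s" if "card J = s" for J
  proof -
    have "Arg (entry (cand J) \<xi>) = entry (restr J) \<xi>" for \<xi>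
      unfolding cand_def entry_polar using r range[of \<xi>] pi_gt_zero
      by (simp add: restr_entry Arg_cis)
    then have "{\<xi>. entry (map_matrix Arg (cand J)) \<xi> \<noteq> 0} \<subseteq> J"
      by (auto simp: restr_entry split: if_splits)
    then have "norm0 (map_matrix Arg (cand J)) \<le> s"
      unfolding norm0_def using that card_mono finite by blast
    moreover have "cand J \<in> Omega2 X"
      unfolding cand_def using assms(2) r by (intro polar_in_Omega2) simp
    ultimately show ?thesis by (simp add: Omega3_def)
  qed
  \<comment> \<open>Any \<open>J\<close> of size \<open>s\<close> that contains the indices where the argument of \<open>w\<close> is nonzero will do.\<close>
  have Omega3_cover: "\<exists>J. card J = s \<and> (\<forall>\<xi>\<in>- J. entry w \<xi> = of_real r)" if "w \<in> Omega3 X s" for w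
  proof -
    have "card {\<xi>. entry (map_matrix Arg w) \<xi> \<noteq> 0} \<le> s"
      using that by (simp add: Omega3_def norm0_def)
    moreover have "s \<le> CARD('n \<times> 'n)"
      using assms(3) by (simp add: power2_eq_square)
    ultimately obtain J where J: "{\<xi>. entry (map_matrix Arg w) \<xi> \<noteq> 0} \<subseteq> J" "card J = s"
      by (rule exists_superset_card_eq)
    have "entry w \<xi> = of_real r" if "\<xi> \<in> - J" for \<xi>
    proof -
      have "Arg (entry w \<xi>) = 0" using J that by auto
      moreover have "cmod (entry w \<xi>) = r"
        using \<open>w \<in> Omega3 X s\<close> assms(2) by (auto simp: Omega3_def Omega2_def)
      ultimately show ?thesis
        using Arg_eq[of "entry w \<xi>"] r by auto
    qed
    then show ?thesis using J by blast
  qed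
  have dist2_split: "(norm (x - w))\<^sup>2 = (\<Sum>\<xi>\<in>J. (cmod (entry x \<xi> - entry w \<xi>))\<^sup>2) + sum g (- J)"
    if "\<forall>\<xi>\<in>- J. entry w \<xi> = of_real r" for w J
    unfolding dist2 split[of _ J] using that by (simp add: g_def)
  have "projector (Omega3 X s) x = cand ` C_sets s \<Phi>"
  proof (intro set_eqI iffI)
    fix w
    assume "w \<in> projector (Omega3 X s) x"
    then have w: "w \<in> Omega3 X s" and min: "\<And>v. v \<in> Omega3 X s \<Longrightarrow> norm (x - w) \<le> norm (x - v)"
      by (auto simp: projector_iff)
    obtain J where J: "card J = s" "\<forall>\<xi>\<in>- J. entry w \<xi> = of_real r"
      using Omega3_cover[OF w] by blast
    have opt: "(\<Sum>\<xi>\<in>J. (cmod (entry x \<xi> - entry w \<xi>))\<^sup>2) + sum g (- J) \<le> sum g (- K)"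
      if "card K = s" for K
      using power_mono[OF min[OF cand_mem[OF that]] norm_ge_zero, of 2]
      unfolding dist2_split[OF J(2)] cand_dist2 .
    \<comment> \<open>Comparing with \<open>cand J\<close> itself shows that \<open>w\<close> pays nothing on \<open>J\<close>.\<close>
    have "(\<Sum>\<xi>\<in>J. (cmod (entry x \<xi> - entry w \<xi>))\<^sup>2) = 0"
      using opt[OF J(1)] by (intro antisym sum_nonneg) auto
    then have "\<forall>\<xi>\<in>J. entry w \<xi> = entry x \<xi>" and "J \<in> C_sets s \<Phi>"
      using opt J(1) by (auto simp: sum_nonneg_eq_0_iff C_iff)
    moreover from this have "w = cand J"
      using J(2) by (intro array_eqI) (simp add: cand_entry)
    ultimately show "w \<in> cand ` C_sets s \<Phi>" by blast
  next
    fix w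
    assume "w \<in> cand ` C_sets s \<Phi>"
    then obtain J where w: "w = cand J" and J: "J \<in> C_sets s \<Phi>" by blast
    have "norm (x - cand J) \<le> norm (x - v)" if v: "v \<in> Omega3 X s" for v
    proof -
      obtain K where K: "card K = s" "\<forall>\<xi>\<in>- K. entry v \<xi> = of_real r"
        using Omega3_cover[OF v] by blast
      have "sum g (- J) \<le> sum g (- K)" using J K(1) by (simp add: C_iff)
      also have "\<dots> \<le> (norm (x - v))\<^sup>2"
        using dist2_split[OF K(2)] by (simp add: sum_nonneg)
      finally show ?thesis
        by (rule power2_le_imp_le[OF ord_eq_le_trans[OF cand_dist2]]) simp
    qed
    then show "w \<in> projector (Omega3 X s) x"
      using J cand_mem by (simp add: w projector_iff C_iff)
  qed
  also have "\<dots> = {map_matrix complex_of_real X \<odot> cexp_array \<phi> | \<phi> :: real ^ 'n ^ 'n.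
      \<exists>J\<in>C_sets s \<Phi>. (\<forall>\<xi>\<in>J. entry \<phi> \<xi> = entry \<Phi> \<xi>) \<and> (\<forall>\<xi>\<in>- J. entry \<phi> \<xi> = 0)}"
  proof -
    have "(\<forall>\<xi>\<in>J. entry \<phi> \<xi> = entry \<Phi> \<xi>) \<and> (\<forall>\<xi>\<in>- J. entry \<phi> \<xi> = 0) \<longleftrightarrow> \<phi> = restr J" for \<phi> J
    proof
      assume "(\<forall>\<xi>\<in>J. entry \<phi> \<xi> = entry \<Phi> \<xi>) \<and> (\<forall>\<xi>\<in>- J. entry \<phi> \<xi> = 0)"
      then show "\<phi> = restr J" by (intro array_eqI) (simp add: restr_entry)
    qed (simp add: restr_entry)
    then show ?thesis by (auto simp: cand_def)
  qed
  finally show ?thesis .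
qed

end
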